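(* $\mathfrak{s}(\mathbb{R})\leq\max\{\mathfrak{b},\mathrm{non}(\mathcal{N})\}$.
   Context: $\mathfrak{b}$ is the bounding number (least size of a family of functions $\omega\to\omega$ unbounded modulo finite). $\mathrm{non}(\mathcal{N})$ is the least cardinality of a non-Lebesgue-measurable subset of $2^\omega$ (equivalently of $\mathbb{R}$). For infinite sets $U, A$, say $U$ splits $A$ if both $A\cap U$ and $A\setminus U$ are infinite. $\mathfrak{s}(\mathbb{R})$ is the smallest cardinality of a family $\mathcal{U}$ of open subsets of $\mathbb{R}$ (usual topology) such that every infinite $A\subseteq\mathbb{R}$ is split by some $U\in\mathcal{U}$. *)

theory Defs
  imports "HOL-Analysis.Analysis"
begin

definition splits :: "'a set \<Rightarrow> 'a set \<Rightarrow> bool" where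
  "splits U A \<longleftrightarrow> infinite (A \<inter> U) \<and> infinite (A - U)"

text \<open>A family of open subsets of the reals such that every infinite set of reals
  is split by some member (a witness family for s(R)).\<close>
definition open_splitting_family :: "real set set \<Rightarrow> bool" where
  "open_splitting_family \<U> \<longleftrightarrow>
     (\<forall>U\<in>\<U>. open U) \<and> (\<forall>A::real set. infinite A \<longrightarrow> (\<exists>U\<in>\<U>. splits U A))"

text \<open>A family of functions omega to omega that is unbounded modulo finite
  (a witness family for the bounding number b).\<close>
definition unbounded_family :: "(nat \<Rightarrow> nat) set \<Rightarrow> bool" where
  "unbounded_family F \<longleftrightarrow> \<not> (\<exists>g. \<forall>f\<in>F. \<forall>\<^sub>F n in sequentially. f n \<le> g n)"

text \<open>A non-Lebesgue-measurable set of reals (a witness for non(N)).\<close>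
definition non_measurable :: "real set \<Rightarrow> bool" where
  "non_measurable X \<longleftrightarrow> X \<notin> sets lebesgue"

end

theory Submission
  imports Defs
begin

text \<open>Let a real \<open>x\<close> encode random choices through its digits. Given \<open>f\<close>, choose at each level \<open>m\<close>
  every interval of a grid of mesh \<open>2\<^sup>-\<^sup>f\<^sup>(\<^sup>m\<^sup>)\<close> independently with probability \<open>2\<^sup>-\<^sup>m\<close>, and let
  \<open>U(f, M, x)\<close> be the union of all intervals chosen at levels \<open>m \<ge> M\<close>. Let \<open>a\<close> be an injective sequence
  in an infinite set \<open>A\<close>. Each \<open>a\<^sub>n\<close> lies in \<open>U(f, M, x)\<close> with probability at most \<open>4 \<cdot> 2\<^sup>-\<^sup>M\<close>,
  so almost surely some \<open>U(f, M, x)\<close> omits infinitely many \<open>a\<^sub>n\<close>. Conversely, let \<open>K\<^sub>m\<close> be so large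
  that among \<open>K\<^sub>m\<close> different intervals of level \<open>m\<close> one is chosen with probability at least
  \<open>1 - 2\<^sup>-\<^sup>m\<close>, and \<open>g(m)\<close> so large that the grid of mesh \<open>2\<^sup>-\<^sup>g\<^sup>(\<^sup>m\<^sup>)\<close> separates \<open>K\<^sub>m\<close> of the points
  \<open>a\<^sub>n\<close> with \<open>n \<ge> m\<close>. If \<open>f(m) > g(m)\<close> infinitely often, then almost surely every \<open>U(f, M, x)\<close> contains
  infinitely many \<open>a\<^sub>n\<close>. An unbounded family contains such an \<open>f\<close>, and a nonmeasurable set,
  not being null, contains an \<open>x\<close> for which both almost sure events occur.\<close>

section \<open>Digit expansions and the measure of digit events\<close>

text \<open>The digit at position \<^term>\<open>i\<close> after the point in base \<^term>\<open>b\<close>; a uniformly distributed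
  real supplies independent digits.\<close>
definition digit :: "int \<Rightarrow> nat \<Rightarrow> real \<Rightarrow> int" where
  "digit b i x = \<lfloor>of_int b ^ Suc i * x\<rfloor> mod b"

lemma digit_add_of_int: "digit b i (x + of_int z) = digit b i x"
proof -
  have "\<lfloor>of_int b ^ Suc i * (x + of_int z)\<rfloor> = \<lfloor>of_int b ^ Suc i * x + of_int (b ^ Suc i * z)\<rfloor>"
    by (simp add: algebra_simps)
  also have "\<dots> = \<lfloor>of_int b ^ Suc i * x\<rfloor> + b * (b ^ i * z)"
    by (simp only: floor_add_int [symmetric] power_Suc mult.assoc)
  finally show ?thesis by (simp add: digit_def)
qed

lemma measurable_digit [measurable]: "digit b i \<in> measurable borel (count_space UNIV)"
  unfolding digit_def by measurable

text \<open>The map from \<open>y\<close> to \<open>(d + y) / b\<close> is an inverse branch of the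
  shift on expansions: it puts \<open>d\<close> in front of the digits of \<open>y\<close>.\<close>

lemma digit_shift:
  assumes "b > 0" "0 \<le> d" "d < b" "y \<in> {0..<1}"
  shows "digit b 0 ((of_int d + y) / of_int b) = d"
    and "digit b (Suc i) ((of_int d + y) / of_int b) = digit b i y"
proof -
  have *: "of_int b ^ Suc i * ((of_int d + y) / of_int b) = of_int (b ^ i * d) + of_int b ^ i * y" for i
    using assms by (simp add: field_simps)
  have "\<lfloor>y\<rfloor> = 0" using assms by (simp add: floor_eq_iff)
  then show "digit b 0 ((of_int d + y) / of_int b) = d"
    using assms *[of 0] by (simp add: digit_def)
  have "digit b (Suc i) ((of_int d + y) / of_int b) = (b ^ Suc i * d + \<lfloor>of_int b ^ Suc i * y\<rfloor>) mod b"
    unfolding digit_def * by (metis floor_add_int add.commute)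
  then show "digit b (Suc i) ((of_int d + y) / of_int b) = digit b i y"
    by (simp add: digit_def mult.assoc)
qed

text \<open>Independence comes from self-similarity: fixing the first digit leaves a copy, scaled by
  \<open>1 / b\<close>, of the event for the later digits, so the factors multiply along an
  induction on \<open>n\<close>.\<close>

lemma emeasure_digits_le:
  assumes b: "b > 0" and Q: "\<And>i. Q i \<subseteq> {0..<b}"
  shows "emeasure lebesgue {x\<in>{0..<1}. \<forall>i<n. digit b i x \<in> Q i}
           \<le> ennreal (\<Prod>i<n. card (Q i) / of_int b)"
  using Q
proof (induction n arbitrary: Q)
  case 0
  have "{x::real. 0 \<le> x \<and> x < 1} = {0..<1}" by auto
  then show ?case by simp
next
  case (Suc n)
  define P where "P = {x\<in>{0..<1}. \<forall>i<n. digit b i x \<in> Q (Suc i)}"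
  define h where "h = (\<lambda>d::int. \<lambda>x::real. (1 / of_int b) *\<^sub>R x + of_int d / of_int b)"
  have fin: "finite (Q 0)" using Suc.prems[of 0] finite_subset by blast
  have [measurable]: "P \<in> sets borel" unfolding P_def by measurable
  have em: "emeasure lebesgue (h d ` P) = ennreal (1 / of_int b) * emeasure lebesgue P" for d
    unfolding h_def using b by (subst emeasure_lebesgue_affine) simp
  have meas: "h d ` P \<in> sets lebesgue" for d
  proof -
    \<comment> \<open>Written as a preimage under an affine map, the image is visibly Borel.\<close>
    have "h d ` P = {x. of_int b * x - of_int d \<in> P}"
    proof (intro equalityI subsetI)
      fix x assume "x \<in> {x. of_int b * x - of_int d \<in> P}"
      moreover have "x = h d (of_int b * x - of_int d)"
        using b by (simp add: h_def field_simps)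
      ultimately show "x \<in> h d ` P" by blast
    qed (use b in \<open>auto simp: h_def field_simps\<close>)
    also have "\<dots> \<in> sets borel" by measurable
    finally show ?thesis by auto
  qed
  have "{x\<in>{0..<1}. \<forall>i<Suc n. digit b i x \<in> Q i} \<subseteq> (\<Union>d\<in>Q 0. h d ` P)"
  proof
    fix x :: real assume x: "x \<in> {x\<in>{0..<1}. \<forall>i<Suc n. digit b i x \<in> Q i}"
    define d where "d = \<lfloor>of_int b * x\<rfloor>"
    define y where "y = of_int b * x - of_int d"
    have y: "y \<in> {0..<1}" unfolding y_def d_def by (auto; linarith)
    have d: "0 \<le> d" "d < b" using x b by (auto simp: d_def floor_less_iff)
    have xe: "x = (of_int d + y) / of_int b" using b by (simp add: y_def)
    have "digit b 0 x \<in> Q 0" using x by auto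
    then have "d \<in> Q 0" using digit_shift(1)[OF b d y] xe by simp
    moreover have "digit b i y \<in> Q (Suc i)" if "i < n" for i
    proof -
      have "digit b (Suc i) x \<in> Q (Suc i)" using x that by auto
      then show ?thesis using digit_shift(2)[OF b d y] xe by simp
    qed
    then have "y \<in> P" using y by (auto simp: P_def)
    moreover have "x = h d y" using xe by (simp add: h_def add_divide_distrib)
    ultimately show "x \<in> (\<Union>d\<in>Q 0. h d ` P)" by blast
  qed
  then have "emeasure lebesgue {x\<in>{0..<1}. \<forall>i<Suc n. digit b i x \<in> Q i}
      \<le> emeasure lebesgue (\<Union>d\<in>Q 0. h d ` P)"
    using meas fin by (intro emeasure_mono) auto
  also have "\<dots> \<le> (\<Sum>d\<in>Q 0. emeasure lebesgue (h d ` P))"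
    using meas fin by (intro emeasure_subadditive_finite) auto
  also have "\<dots> = of_nat (card (Q 0)) * (ennreal (1 / of_int b) * emeasure lebesgue P)"
    by (simp add: em)
  also have "\<dots> \<le> of_nat (card (Q 0)) * (ennreal (1 / of_int b) *
      ennreal (\<Prod>i<n. card (Q (Suc i)) / of_int b))"
    unfolding P_def using Suc.prems by (intro mult_left_mono Suc.IH) auto
  also have "\<dots> = ennreal (card (Q 0) / of_int b * (\<Prod>i<n. card (Q (Suc i)) / of_int b))"
    using b by (simp add: ennreal_of_nat_eq_real_of_nat ennreal_mult' [symmetric] prod_nonneg)
  also have "\<dots> = ennreal (\<Prod>i<Suc n. card (Q i) / of_int b)"
    by (simp add: prod.lessThan_Suc_shift del: prod.lessThan_Suc)
  finally show ?case .
qed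

lemma emeasure_digit_zero_le:
  assumes "b > 0"
  shows "emeasure lebesgue {x\<in>{0..<1}. digit b i x = 0} \<le> ennreal (1 / of_int b)"
proof -
  \<comment> \<open>Full digit sets at the positions before \<open>i\<close> contribute the factor
    1.\<close>
  define Q where "Q = (\<lambda>j. if j = i then {0} else {0..<b})"
  have "{x\<in>{0..<1}. digit b i x = 0} = {x\<in>{0..<1}. \<forall>j<Suc i. digit b j x \<in> Q j}"
    using assms by (auto simp: Q_def digit_def)
  then have "emeasure lebesgue {x\<in>{0..<1}. digit b i x = 0}
      \<le> ennreal (\<Prod>j<Suc i. card (Q j) / of_int b)"
    using emeasure_digits_le[of b Q "Suc i"] assms by (auto simp: Q_def)
  also have "(\<Prod>j<Suc i. card (Q j) / of_int b) = 1 / of_int b"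
    using assms by (simp add: Q_def)
  finally show ?thesis .
qed

lemma emeasure_digits_nonzero_le:
  assumes "b > 0" "finite S"
  shows "emeasure lebesgue {x\<in>{0..<1}. \<forall>i\<in>S. digit b i x \<noteq> 0}
           \<le> ennreal ((1 - 1 / of_int b) ^ card S)"
proof -
  define Q where "Q = (\<lambda>j. if j \<in> S then {1..<b} else {0..<b})"
  obtain n where n: "S \<subseteq> {..<n}" using \<open>finite S\<close> finite_nat_iff_bounded by blast
  have bounds: "0 \<le> digit b j x \<and> digit b j x < b" for j x using assms by (simp add: digit_def)
  have "{x\<in>{0..<1}. \<forall>i\<in>S. digit b i x \<noteq> 0} = {x\<in>{0..<1}. \<forall>j<n. digit b j x \<in> Q j}"
  proof -
    have "(\<forall>i\<in>S. digit b i x \<noteq> 0) \<longleftrightarrow> (\<forall>j<n. digit b j x \<in> Q j)" for x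
    proof -
      have "digit b j x \<in> Q j \<longleftrightarrow> (j \<in> S \<longrightarrow> digit b j x \<noteq> 0)" for j
        using bounds[of j x] by (auto simp: Q_def)
      then show ?thesis using n by auto
    qed
    then show ?thesis by auto
  qed
  then have "emeasure lebesgue {x\<in>{0..<1}. \<forall>i\<in>S. digit b i x \<noteq> 0}
      \<le> ennreal (\<Prod>j<n. card (Q j) / of_int b)"
    using emeasure_digits_le[of b Q n] assms by (auto simp: Q_def)
  also have "(\<Prod>j<n. card (Q j) / of_int b) = (\<Prod>j<n. if j \<in> S then 1 - 1 / of_int b else 1)"
    using assms by (intro prod.cong) (auto simp: Q_def field_simps)
  also have "\<dots> = (\<Prod>j\<in>S. 1 - 1 / of_int b)"
    using n by (simp add: prod.If_cases Int_absorb1)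
  finally show ?thesis by simp
qed

section \<open>Periodic almost sure statements and lower limits of events\<close>

lemma AE_of_periodic:
  fixes P :: "real \<Rightarrow> bool"
  assumes per: "\<And>x z. P (x + of_int z) \<longleftrightarrow> P x"
    and null: "{x\<in>{0..<1}. \<not> P x} \<in> null_sets lebesgue"
  shows "AE x in lebesgue. P x"
proof -
  let ?N = "{x\<in>{0..<1}. \<not> P x}"
  have "negligible ((+) (of_int z) ` ?N)" for z
    using null by (intro negligible_translation) (simp add: negligible_iff_null_sets)
  then have "negligible (\<Union>z. (+) (of_int z) ` ?N)"
    by (intro negligible_countable_Union countable_image) auto
  \<comment> \<open>Every point is an integer translate of its fractional part, so countably many
    translates of \<open>?N\<close> suffice.\<close>
  moreover have "{x. \<not> P x} \<subseteq> (\<Union>z. (+) (of_int z) ` ?N)"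
  proof
    fix x assume "x \<in> {x. \<not> P x}"
    then have "frac x \<in> ?N"
      using per[of x "- \<lfloor>x\<rfloor>"] by (simp add: frac_def) linarith
    moreover have "x = of_int \<lfloor>x\<rfloor> + frac x" by (simp add: frac_def)
    ultimately show "x \<in> (\<Union>z. (+) (of_int z) ` ?N)" by blast
  qed
  ultimately have "negligible {x. \<not> P x}" by (rule negligible_subset)
  then show ?thesis by (simp add: AE_iff_null_sets negligible_iff_null_sets eventually_ae_filter) blast
qed

text \<open>The tail intersections increase with \<open>r\<close>, and each lies inside some
  \<open>V n\<close> of measure at most \<open>e\<close>; continuity from below keeps the
  bound.\<close>

lemma emeasure_liminf_le:
  assumes meas: "\<And>n. V n \<in> sets N" and small: "\<exists>\<^sub>F n in sequentially. emeasure N (V n) \<le> e"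
  shows "emeasure N (\<Union>r. \<Inter>n\<in>{r..}. V n) \<le> e"
proof -
  have inter: "(\<Inter>n\<in>{r..}. V n) \<in> sets N" for r
    using meas by (intro sets.countable_INT) auto
  have "emeasure N (\<Union>r. \<Inter>n\<in>{r..}. V n) = (SUP r. emeasure N (\<Inter>n\<in>{r..}. V n))"
    using inter by (intro SUP_emeasure_incseq [symmetric]) (auto simp: incseq_def)
  also have "\<dots> \<le> e"
  proof (rule SUP_least)
    fix r
    obtain n where "n \<ge> r" "emeasure N (V n) \<le> e"
      using small by (auto simp: frequently_sequentially)
    moreover have "emeasure N (\<Inter>n\<in>{r..}. V n) \<le> emeasure N (V n)"
      using meas \<open>n \<ge> r\<close> by (intro emeasure_mono) auto
    ultimately show "emeasure N (\<Inter>n\<in>{r..}. V n) \<le> e" by order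
  qed
  finally show ?thesis .
qed

lemma emeasure_eq_0I_real:
  assumes "\<And>e::real. e > 0 \<Longrightarrow> emeasure N S \<le> ennreal e"
  shows "emeasure N S = 0"
  using ennreal_le_epsilon[of 0 "emeasure N S"] assms by auto

section \<open>Random open sets\<close>

text \<open>The interval around \<^term>\<open>k\<close> is chosen with probability \<open>2\<^sup>-\<^sup>m\<close>. The intervals of each level
  overlap, so that their open versions still cover the grid points.\<close>
definition random_open :: "(nat \<Rightarrow> nat) \<Rightarrow> nat \<Rightarrow> real \<Rightarrow> real set" where
  "random_open f M x =
     (\<Union>m\<in>{M..}. \<Union>k\<in>{k. digit (2 ^ m) (int_encode k) x = 0}.
        {(of_int k - 1) / 2 ^ f m <..< (of_int k + 1) / 2 ^ f m})"

lemma open_random_open: "open (random_open f M x)"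
  unfolding random_open_def by (intro open_UN ballI open_greaterThanLessThan)

lemma random_open_add_of_int: "random_open f M (x + of_int z) = random_open f M x"
  by (simp add: random_open_def digit_add_of_int)

lemma random_openI:
  assumes "M \<le> m" "digit (2 ^ m) (int_encode \<lfloor>a * 2 ^ f m\<rfloor>) x = 0"
  shows "a \<in> random_open f M x"
proof -
  have "a \<in> {(of_int \<lfloor>a * 2 ^ f m\<rfloor> - 1) / 2 ^ f m <..< (of_int \<lfloor>a * 2 ^ f m\<rfloor> + 1) / 2 ^ f m}"
    by (simp add: pos_divide_less_eq pos_less_divide_eq) linarith
  then show ?thesis
    unfolding random_open_def using assms by (intro UN_I[of m] UN_I[of "\<lfloor>a * 2 ^ f m\<rfloor>"]) simp_all
qed

text \<open>At each level only the intervals centred at the two neighbouring grid points can contain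
  \<open>a\<close>.\<close>

lemma random_openD:
  assumes "a \<in> random_open f M x"
  shows "\<exists>m\<ge>M. digit (2 ^ m) (int_encode \<lfloor>a * 2 ^ f m\<rfloor>) x = 0 \<or>
                digit (2 ^ m) (int_encode (\<lfloor>a * 2 ^ f m\<rfloor> + 1)) x = 0"
proof -
  obtain m k where m: "m \<ge> M" and k: "digit (2 ^ m) (int_encode k) x = 0"
    and a: "(of_int k - 1) / 2 ^ f m < a" "a < (of_int k + 1) / 2 ^ f m"
    using assms unfolding random_open_def by auto
  have "of_int k - 1 < a * 2 ^ f m" "a * 2 ^ f m < of_int k + 1"
    using a by (simp_all add: pos_divide_less_eq pos_less_divide_eq)
  then have "\<lfloor>a * 2 ^ f m\<rfloor> = k \<or> \<lfloor>a * 2 ^ f m\<rfloor> + 1 = k" by linarith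
  then show ?thesis using m k by auto
qed

section \<open>Measure bounds for the two exceptional events\<close>

lemma emeasure_some_digit_zero_le:
  fixes i j :: "nat \<Rightarrow> nat"
  shows "emeasure lebesgue {x\<in>{0..<1}. \<exists>m\<ge>M. digit (2 ^ m) (i m) x = 0 \<or> digit (2 ^ m) (j m) x = 0}
           \<le> ennreal (4 * (1 / 2) ^ M)"
proof -
  define D where "D = (\<lambda>m i. {x\<in>{0..<1}. digit (2 ^ m) i x = 0})"
  have [measurable]: "D m i \<in> sets borel" for m i
    unfolding D_def by measurable
  have D: "emeasure lebesgue (D m i) \<le> ennreal ((1 / 2) ^ m)" for m i
    using emeasure_digit_zero_le[of "2 ^ m" i] by (simp add: D_def power_divide)
  have "{x\<in>{0..<1}. \<exists>m\<ge>M. digit (2 ^ m) (i m) x = 0 \<or> digit (2 ^ m) (j m) x = 0} =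
      (\<Union>m\<in>{M..}. D m (i m) \<union> D m (j m))"
    by (auto simp: D_def)
  \<comment> \<open>The shift to \<open>r + M\<close> turns the union bound into a geometric series:
    two events of measure at most \<open>(1 / 2) ^ m\<close> at each level
    \<open>m \<ge> M\<close>.\<close>
  also have "{M..} = range (\<lambda>r. r + M)"
    by (auto simp: image_iff le_iff_add add.commute)
  also have "(\<Union>m\<in>range (\<lambda>r. r + M). D m (i m) \<union> D m (j m)) =
      (\<Union>r. D (r + M) (i (r + M)) \<union> D (r + M) (j (r + M)))"
    by blast
  also have "emeasure lebesgue \<dots> \<le>
      (\<Sum>r. emeasure lebesgue (D (r + M) (i (r + M)) \<union> D (r + M) (j (r + M))))"
    by (intro emeasure_subadditive_countably) auto
  also have "\<dots> \<le> (\<Sum>r. ennreal (2 * (1 / 2) ^ M * (1 / 2) ^ r))"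
  proof (intro suminf_le summableI)
    fix r
    have "emeasure lebesgue (D (r + M) (i (r + M)) \<union> D (r + M) (j (r + M))) \<le>
        emeasure lebesgue (D (r + M) (i (r + M))) + emeasure lebesgue (D (r + M) (j (r + M)))"
      by (intro emeasure_subadditive) auto
    also have "\<dots> \<le> ennreal ((1 / 2) ^ (r + M)) + ennreal ((1 / 2) ^ (r + M))"
      by (intro add_mono D)
    also have "\<dots> = ennreal (2 * (1 / 2) ^ M * (1 / 2) ^ r)"
      by (simp add: power_add flip: ennreal_plus)
    finally show "emeasure lebesgue (D (r + M) (i (r + M)) \<union> D (r + M) (j (r + M))) \<le>
        ennreal (2 * (1 / 2) ^ M * (1 / 2) ^ r)" .
  qed
  also have "\<dots> = ennreal (4 * (1 / 2) ^ M)"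
  proof -
    have "(\<lambda>r. 2 * (1 / 2) ^ M * (1 / 2) ^ r :: real) sums (2 * (1 / 2) ^ M * (1 / (1 - 1 / 2)))"
      by (intro sums_mult geometric_sums) simp
    then show ?thesis
      by (subst suminf_ennreal_eq) auto
  qed
  finally show ?thesis .
qed

text \<open>Here \<open>i n m\<close> and \<open>j n m\<close> will code the two intervals of level
  \<open>m\<close> near the \<open>n\<close>-th point. For each \<open>M\<close> the lower limit has
  measure at most \<open>4 * (1 / 2) ^ M\<close>, which tends to 0.\<close>

lemma null_sets_eventually_some_digit_zero:
  fixes i j :: "nat \<Rightarrow> nat \<Rightarrow> nat"
  defines "W \<equiv> \<lambda>M n. {x\<in>{0..<1}. \<exists>m\<ge>M. digit (2 ^ m) (i n m) x = 0 \<or> digit (2 ^ m) (j n m) x = 0}"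
  shows "(\<Inter>M. \<Union>r. \<Inter>n\<in>{r..}. W M n) \<in> null_sets lebesgue"
proof -
  have "W M n \<in> sets borel" for M n unfolding W_def by measurable
  then have meas: "W M n \<in> sets lebesgue" for M n by simp
  then have sets: "(\<Union>r. \<Inter>n\<in>{r..}. W M n) \<in> sets lebesgue" for M
    by (intro sets.countable_UN sets.countable_INT) auto
  have "emeasure lebesgue (\<Inter>M. \<Union>r. \<Inter>n\<in>{r..}. W M n) = 0"
  proof (rule emeasure_eq_0I_real)
    fix e :: real assume "e > 0"
    then obtain M where M: "(1 / 2) ^ M < e / 4"
      using real_arch_pow_inv[of "e / 4" "1 / 2"] by auto
    have "emeasure lebesgue (\<Inter>M. \<Union>r. \<Inter>n\<in>{r..}. W M n) \<le> emeasure lebesgue (\<Union>r. \<Inter>n\<in>{r..}. W M n)"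
      by (intro emeasure_mono sets) auto
    also have "\<dots> \<le> ennreal (4 * (1 / 2) ^ M)"
    proof (rule emeasure_liminf_le [OF meas])
      have "emeasure lebesgue (W M n) \<le> ennreal (4 * (1 / 2) ^ M)" for n
        unfolding W_def by (rule emeasure_some_digit_zero_le)
      then show "\<exists>\<^sub>F n in sequentially. emeasure lebesgue (W M n) \<le> ennreal (4 * (1 / 2) ^ M)"
        by (auto simp: frequently_sequentially)
    qed
    also have "\<dots> \<le> ennreal e" using M by (intro ennreal_leI) simp
    finally show "emeasure lebesgue (\<Inter>M. \<Union>r. \<Inter>n\<in>{r..}. W M n) \<le> ennreal e" .
  qed
  moreover have "(\<Inter>M. \<Union>r. \<Inter>n\<in>{r..}. W M n) \<in> sets lebesgue"
    using sets by (intro sets.countable_INT) auto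
  ultimately show ?thesis by (simp add: null_sets_def)
qed

text \<open>Every tail contains \<open>m\<close> in \<open>I\<close> with \<open>V m\<close> of
  arbitrarily small measure. Off \<open>I\<close>, \<open>V m\<close> is the whole unit interval and
  does not affect the intersections.\<close>

lemma null_sets_eventually_digits_nonzero:
  fixes S :: "nat \<Rightarrow> nat set" and I :: "nat set"
  assumes "infinite I" and fin: "\<And>m. finite (S m)"
    and large: "\<And>m. m \<in> I \<Longrightarrow> (1 - (1 / 2) ^ m) ^ card (S m) \<le> (1 / 2 :: real) ^ m"
  defines "V \<equiv> \<lambda>m. {x\<in>{0..<1}. m \<in> I \<longrightarrow> (\<forall>i\<in>S m. digit (2 ^ m) i x \<noteq> 0)}"
  shows "(\<Union>r. \<Inter>m\<in>{r..}. V m) \<in> null_sets lebesgue"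
proof -
  have [measurable]: "V m \<in> sets borel" for m
    unfolding V_def using countable_finite[OF fin[of m]] by measurable
  then have meas: "V m \<in> sets lebesgue" for m by simp
  have "emeasure lebesgue (\<Union>r. \<Inter>m\<in>{r..}. V m) = 0"
  proof (rule emeasure_eq_0I_real)
    fix e :: real assume "e > 0"
    then obtain M where M: "(1 / 2) ^ M < e"
      using real_arch_pow_inv[of e "1 / 2"] by auto
    have "\<exists>m\<ge>r. emeasure lebesgue (V m) \<le> ennreal e" for r
    proof -
      obtain m where m: "m \<in> I" "m \<ge> max r M"
        using \<open>infinite I\<close> by (meson infinite_nat_iff_unbounded_le)
      have "emeasure lebesgue (V m) \<le> ennreal ((1 - (1 / 2) ^ m) ^ card (S m))"
        using emeasure_digits_nonzero_le[of "2 ^ m" "S m"] fin m by (simp add: V_def power_divide)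
      also have "\<dots> \<le> ennreal ((1 / 2) ^ m)"
        using large[OF m(1)] by (intro ennreal_leI)
      also have "\<dots> \<le> ennreal e"
        using M power_decreasing[of M m "1 / 2 :: real"] m by (intro ennreal_leI) linarith
      finally show ?thesis using m by auto
    qed
    then show "emeasure lebesgue (\<Union>r. \<Inter>m\<in>{r..}. V m) \<le> ennreal e"
      by (intro emeasure_liminf_le meas) (simp add: frequently_sequentially)
  qed
  moreover have "(\<Union>r. \<Inter>m\<in>{r..}. V m) \<in> sets lebesgue"
    using meas by (intro sets.countable_UN sets.countable_INT) auto
  ultimately show ?thesis by (simp add: null_sets_def)
qed

section \<open>Separation of points by dyadic grids\<close>

lemma eventually_floor_neq:
  fixes a b :: real
  assumes "a \<noteq> b"
  shows "\<forall>\<^sub>F j in sequentially. \<lfloor>a * 2 ^ j\<rfloor> \<noteq> \<lfloor>b * 2 ^ j\<rfloor>"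
proof -
  obtain J where J: "1 / \<bar>a - b\<bar> < 2 ^ J"
    using real_arch_pow[of 2 "1 / \<bar>a - b\<bar>"] by auto
  have "\<lfloor>a * 2 ^ j\<rfloor> \<noteq> \<lfloor>b * 2 ^ j\<rfloor>" if "j \<ge> J" for j
  proof -
    have "1 / \<bar>a - b\<bar> < 2 ^ j"
      using J that by (meson le_less_trans less_le_trans one_le_numeral power_increasing)
    then have "1 < \<bar>a - b\<bar> * 2 ^ j" using assms by (simp add: field_simps)
    also have "\<dots> = \<bar>a * 2 ^ j - b * 2 ^ j\<bar>" by (simp add: abs_mult flip: left_diff_distrib)
    finally show ?thesis by linarith
  qed
  then show ?thesis by (auto simp: eventually_sequentially)
qed

lemma eventually_inj_on_floor:
  fixes T :: "real set"
  assumes "finite T"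
  shows "\<forall>\<^sub>F j in sequentially. inj_on (\<lambda>a. \<lfloor>a * 2 ^ j\<rfloor>) T"
proof -
  have "\<forall>\<^sub>F j in sequentially. \<forall>a\<in>T. \<forall>b\<in>T. a \<noteq> b \<longrightarrow> \<lfloor>a * 2 ^ j\<rfloor> \<noteq> \<lfloor>b * 2 ^ j\<rfloor>"
    using assms eventually_floor_neq by (intro eventually_ball_finite ballI) auto
  then show ?thesis by (rule eventually_mono) (auto simp: inj_on_def)
qed

section \<open>Almost sure splitting of one infinite set\<close>

lemma infinite_Int_of_frequently:
  fixes a :: "nat \<Rightarrow> 'a"
  assumes "inj a" "range a \<subseteq> A" "\<exists>\<^sub>F n in sequentially. a n \<in> B"
  shows "infinite (A \<inter> B)"
proof -
  have "infinite {n. a n \<in> B}"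
    using assms(3) by (simp add: cofinite_eq_sequentially [symmetric] INFM_iff_infinite)
  then have "infinite (a ` {n. a n \<in> B})"
    using \<open>inj a\<close> by (metis finite_imageD inj_on_subset subset_UNIV)
  moreover have "a ` {n. a n \<in> B} \<subseteq> A \<inter> B" using assms(2) by auto
  ultimately show ?thesis using finite_subset by blast
qed

text \<open>The bound \<open>g\<close> is found from \<open>A\<close> before any \<open>f\<close> is
  given, so an unbounded family must contain an \<open>f\<close> that escapes it.\<close>

lemma AE_random_open_splits:
  assumes "infinite A"
  obtains g where "\<And>f. \<not> (\<forall>\<^sub>F m in sequentially. f m \<le> g m) \<Longrightarrow>
    AE x in lebesgue. \<exists>M. splits (random_open f M x) A"
proof -
  obtain a :: "nat \<Rightarrow> real" where a: "inj a" "range a \<subseteq> A"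
    using infinite_countable_subset[OF assms] by blast
  have "\<exists>K. (1 - (1 / 2) ^ m) ^ K \<le> (1 / 2 :: real) ^ m" for m
    using real_arch_pow_inv[of "(1 / 2) ^ m" "1 - (1 / 2 :: real) ^ m"] less_imp_le by fastforce
  then obtain K where K: "\<And>m. (1 - (1 / 2) ^ m) ^ K m \<le> (1 / 2 :: real) ^ m" by metis
  \<comment> \<open>The block starts at \<open>m\<close>, so that hits at arbitrarily high levels
    have arbitrarily large indices.\<close>
  have "\<exists>J. \<forall>j\<ge>J. inj_on (\<lambda>a. \<lfloor>a * 2 ^ j\<rfloor>) (a ` {m..<m + K m})" for m
    using eventually_inj_on_floor[of "a ` {m..<m + K m}"] by (simp add: eventually_sequentially)
  then obtain g where g: "\<And>m j. j \<ge> g m \<Longrightarrow> inj_on (\<lambda>a. \<lfloor>a * 2 ^ j\<rfloor>) (a ` {m..<m + K m})"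
    by metis
  show thesis
  proof (rule that)
    fix f assume "\<not> (\<forall>\<^sub>F m in sequentially. f m \<le> g m)"
    define I where "I = {m. f m > g m}"
    have I: "infinite I"
      using \<open>\<not> (\<forall>\<^sub>F m in sequentially. f m \<le> g m)\<close>
      by (simp add: I_def cofinite_eq_sequentially [symmetric] eventually_cofinite not_le)
    \<comment> \<open>\<open>c\<close> and \<open>c'\<close> code the two grid points next to
      \<open>a n\<close>: a zero digit at \<open>c\<close> catches the point, nonzero digits at both
      leave it out.\<close>
    define c where "c = (\<lambda>n m. int_encode \<lfloor>a n * 2 ^ f m\<rfloor>)"
    define c' where "c' = (\<lambda>n m. int_encode (\<lfloor>a n * 2 ^ f m\<rfloor> + 1))"
    define S where "S = (\<lambda>m. (\<lambda>n. c n m) ` {m..<m + K m})"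
    define W where "W = (\<lambda>M n. {x\<in>{0..<1}. \<exists>m\<ge>M. digit (2 ^ m) (c n m) x = 0 \<or> digit (2 ^ m) (c' n m) x = 0})"
    define V where "V = (\<lambda>m. {x\<in>{0..<1}. m \<in> I \<longrightarrow> (\<forall>i\<in>S m. digit (2 ^ m) i x \<noteq> 0)})"
    have "(\<Inter>M. \<Union>r. \<Inter>n\<in>{r..}. W M n) \<in> null_sets lebesgue"
      unfolding W_def by (rule null_sets_eventually_some_digit_zero)
    moreover have "(\<Union>r. \<Inter>m\<in>{r..}. V m) \<in> null_sets lebesgue"
      unfolding V_def
    proof (rule null_sets_eventually_digits_nonzero [OF I])
      show "finite (S m)" for m by (simp add: S_def)
      fix m assume "m \<in> I"
      then have "inj_on (\<lambda>a. \<lfloor>a * 2 ^ f m\<rfloor>) (a ` {m..<m + K m})" using g by (simp add: I_def)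
      then have "inj_on (\<lambda>n. c n m) {m..<m + K m}"
        using a(1) by (auto simp: c_def inj_on_def inj_def int_encode_eq)
      then have "card (S m) = K m" by (simp add: S_def card_image)
      then show "(1 - (1 / 2) ^ m) ^ card (S m) \<le> (1 / 2 :: real) ^ m" using K by simp
    qed
    ultimately have null: "(\<Inter>M. \<Union>r. \<Inter>n\<in>{r..}. W M n) \<union> (\<Union>r. \<Inter>m\<in>{r..}. V m) \<in> null_sets lebesgue"
      by (rule null_sets.Un)
    have splits: "\<exists>M. splits (random_open f M x) A"
      if x: "x \<in> {0..<1}" and W: "x \<notin> (\<Inter>M. \<Union>r. \<Inter>n\<in>{r..}. W M n)"
        and V: "x \<notin> (\<Union>r. \<Inter>m\<in>{r..}. V m)" for x
    proof -
      obtain M where M: "\<And>r. \<exists>n\<ge>r. x \<notin> W M n" using W by (auto simp: Bex_def)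
      have "a n \<in> - random_open f M x" if "x \<notin> W M n" for n
        using that x random_openD[of "a n" f M x] by (auto simp: W_def c_def c'_def)
      with M have out: "\<exists>\<^sub>F n in sequentially. a n \<in> - random_open f M x"
        by (auto simp: frequently_sequentially)
      have "\<exists>n\<ge>r. a n \<in> random_open f M x" for r
      proof -
        \<comment> \<open>\<open>m \<ge> M\<close> makes level \<open>m\<close> part of the union,
          and \<open>m \<ge> r\<close> forces the index of the point caught to be at least
          \<open>r\<close>.\<close>
        obtain m where "m \<in> {max r M..}" "x \<notin> V m" using V by blast
        then have "m \<ge> max r M" by simp
        obtain n where "n \<ge> m" "digit (2 ^ m) (c n m) x = 0"
          using x \<open>x \<notin> V m\<close> by (auto simp: V_def S_def)
        then have "n \<ge> r" "a n \<in> random_open f M x"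
          using \<open>m \<ge> max r M\<close> random_openI[of M m "a n" f x] by (auto simp: c_def)
        then show ?thesis by blast
      qed
      then have "\<exists>\<^sub>F n in sequentially. a n \<in> random_open f M x"
        by (simp add: frequently_sequentially)
      then have "splits (random_open f M x) A"
        using out infinite_Int_of_frequently[OF a] unfolding splits_def Diff_eq by blast
      then show ?thesis by blast
    qed
    show "AE x in lebesgue. \<exists>M. splits (random_open f M x) A"
    proof (rule AE_of_periodic)
      \<comment> \<open>The exceptional set is covered by a null set; completeness of Lebesgue
        measure then gives its measurability.\<close>
      show "{x \<in> {0..<1}. \<not> (\<exists>M. splits (random_open f M x) A)} \<in> null_sets lebesgue"
        using splits by (intro null_sets_completion_subset [OF _ null]) blast
    qed (simp add: random_open_add_of_int)
  qed
qed

section \<open>The cardinal bound and the theorem\<close>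

lemma card_of_Times_ordLeq:
  assumes "infinite C" "(card_of A, card_of C) \<in> ordLeq" "(card_of B, card_of C) \<in> ordLeq"
  shows "(card_of (A \<times> B), card_of C) \<in> ordLeq"
  using assms by (intro card_of_Times_ordLeq_infinite_Field) (simp_all add: Field_card_of card_of_card_order_on)

text \<open>\<open>X\<close> absorbs the countable factor, then the larger of \<open>F\<close> and
  \<open>X\<close> absorbs the product; the disjunction expresses a bound by the maximum.\<close>

lemma card_of_Times_nat_Times:
  assumes "infinite X"
  shows "(card_of (F \<times> (UNIV :: nat set) \<times> X), card_of F) \<in> ordLeq \<or>
         (card_of (F \<times> (UNIV :: nat set) \<times> X), card_of X) \<in> ordLeq"
proof -
  have nat: "(card_of (UNIV :: nat set), card_of X) \<in> ordLeq"
    using assms by (simp add: infinite_iff_card_of_nat)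
  have nX: "(card_of ((UNIV :: nat set) \<times> X), card_of X) \<in> ordLeq"
    by (rule card_of_Times_ordLeq[OF assms nat ordLeq_refl[OF card_of_Card_order]])
  have "(card_of F, card_of X) \<in> ordLeq \<or> (card_of X, card_of F) \<in> ordLeq"
    by (rule ordLeq_total[OF card_of_Well_order card_of_Well_order])
  then show ?thesis
  proof
    assume "(card_of F, card_of X) \<in> ordLeq"
    from card_of_Times_ordLeq[OF assms this nX] show ?thesis ..
  next
    assume XF: "(card_of X, card_of F) \<in> ordLeq"
    then have "infinite F" using assms card_of_ordLeq_finite by metis
    from card_of_Times_ordLeq[OF this ordLeq_refl[OF card_of_Card_order] ordLeq_transitive[OF nX XF]]
    show ?thesis ..
  qed
qed

theorem theorem4p2:
  fixes F :: "(nat \<Rightarrow> nat) set" and X :: "real set"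
  assumes "unbounded_family F" and "non_measurable X"
  shows "\<exists>\<U>. open_splitting_family \<U> \<and>
           ((card_of \<U>, card_of F) \<in> ordLeq \<or> (card_of \<U>, card_of X) \<in> ordLeq)"
proof -
  \<comment> \<open>\<open>M\<close> ranges over all naturals because the suitable one depends on
    \<open>A\<close>, \<open>f\<close> and \<open>x\<close>.\<close>
  define \<U> where "\<U> = (\<lambda>(f, M, x). random_open f M x) ` (F \<times> UNIV \<times> X)"
  have "\<exists>U\<in>\<U>. splits U A" if A: "infinite A" for A
  proof -
    obtain g where g: "\<And>f. \<not> (\<forall>\<^sub>F m in sequentially. f m \<le> g m) \<Longrightarrow>
        AE x in lebesgue. \<exists>M. splits (random_open f M x) A"
      using AE_random_open_splits[OF A] by blast
    obtain f where f: "f \<in> F" "\<not> (\<forall>\<^sub>F m in sequentially. f m \<le> g m)"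
      using assms(1) by (auto simp: unbounded_family_def)
    obtain N where N: "N \<in> null_sets lebesgue" "{x. \<not> (\<exists>M. splits (random_open f M x) A)} \<subseteq> N"
      using g[OF f(2)] by (auto simp only: eventually_ae_filter space_completion space_lborel) auto
    \<comment> \<open>By completeness every subset of a null set is null and hence measurable, so
      \<open>X\<close> is not contained in \<open>N\<close>.\<close>
    have "X \<notin> null_sets lebesgue" using assms(2) by (auto simp: non_measurable_def)
    then obtain x where "x \<in> X" "x \<notin> N"
      using N(1) null_sets_completion_subset[of X N lborel] by blast
    then obtain M where "splits (random_open f M x) A"
      using N(2) by blast
    moreover have "random_open f M x \<in> \<U>"
      unfolding \<U>_def using f(1) \<open>x \<in> X\<close> by (intro image_eqI[of _ _ "(f, M, x)"]) auto
    ultimately show ?thesis by blast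
  qed
  then have "open_splitting_family \<U>"
    by (auto simp: open_splitting_family_def \<U>_def open_random_open)
  \<comment> \<open>Finite sets are negligible and hence measurable.\<close>
  moreover have "infinite X"
    using assms(2) negligible_imp_sets[OF negligible_finite] by (auto simp: non_measurable_def)
  then have "(card_of \<U>, card_of F) \<in> ordLeq \<or> (card_of \<U>, card_of X) \<in> ordLeq"
    unfolding \<U>_def by (rule disj_forward [OF card_of_Times_nat_Times]) (erule ordLeq_transitive [OF card_of_image])+
  ultimately show ?thesis by blast
qed

end
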